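(* For every $0<\eta<1$ and every $M<\infty$, there is a Euclidean $2$-means instance $X$ (a finite set $X\subset\mathbb{R}^d$) and a support-preserving sampling rule for choosing two centers, whose first center is chosen uniformly from $X$ and whose second (the only nontrivial) sampling round uses, for every possible first center, a distribution within total variation distance $\eta$ of the exact $D^2$-sampling distribution, such that the set $C$ of two selected centers satisfies $$\frac{\mathbf{E}[\varphi(X,C)]}{\mathrm{OPT}_2(X)}>M .$$ Thus no finite approximation guarantee depending only on $k$ and $\eta$ is possible for the relaxation of noisy $k$-means++ in which the sampling distribution of every round is only required to be within total variation distance $\eta$ of the exact one.
   Context: For finite $X\subset\mathbb{R}^d$ and a nonempty finite set $C\subset\mathbb{R}^d$, $\varphi(X,C)=\sum_{x\in X}\min_{c\in C}\|x-c\|^2$, $\varphi(x,C):=\varphi(\{x\},C)$, and $\mathrm{OPT}_k(X)=\min_{C\subset\mathbb{R}^d,|C|=k}\varphi(X,C)$. Given current centers $C_j$, the exact $D^2$-sampling distribution on $X$ is $p_{C_j}(x)=\varphi(x,C_j)/\varphi(X,C_j)$. $k$-means++ chooses the first center uniformly from $X$, and each later center from $p_{C_j}$, adding it to $C_j$. For distributions $p,q$ on a finite set $X$, $\|p-q\|_{\mathrm{TV}}=\frac12\sum_{x\in X}|p(x)-q(x)|$. A sampling rule is support-preserving if each distribution $q$ it uses has the same support as the exact distribution $p$ of that round. *)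

theory Defs
  imports "HOL-Probability.Probability" "Jordan_Normal_Form.Matrix"
begin

text \<open>
  Points of \<open>\<real>\<^sup>d\<close> are the elements of \<^term>\<open>carrier_vec d :: real vec set\<close>, so that the
  dimension can be quantified inside formulas.
\<close>

definition sq_dist :: "real vec \<Rightarrow> real vec \<Rightarrow> real" where
  "sq_dist x c = scalar_prod (x - c) (x - c)"

definition kcost :: "real vec set \<Rightarrow> real vec set \<Rightarrow> real" where
  "kcost X C = (\<Sum>x\<in>X. Min (sq_dist x ` C))"

text \<open>
  The minimum over all \<open>k\<close>-element center sets is written as an infimum of reals (for
  \<open>d, k \<ge> 1\<close> and finite \<open>X\<close> it is attained).
\<close>
definition opt_cost :: "nat \<Rightarrow> nat \<Rightarrow> real vec set \<Rightarrow> real" where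
  "opt_cost d k X = (INF C\<in>{C. C \<subseteq> carrier_vec d \<and> finite C \<and> card C = k}. kcost X C)"

text \<open>
  The condition \<open>k \<le> card X\<close> gives \<open>kcost X C > 0\<close> whenever \<open>card C < k\<close>; hence the
  \<open>D\<^sup>2\<close>-distribution is well defined in each of the \<open>k\<close> rounds.
\<close>
definition kmeans_instance :: "nat \<Rightarrow> nat \<Rightarrow> real vec set \<Rightarrow> bool" where
  "kmeans_instance d k X \<longleftrightarrow>
     1 \<le> d \<and> finite X \<and> X \<subseteq> carrier_vec d \<and> 1 \<le> k \<and> k \<le> card X"

definition D2_prob :: "real vec set \<Rightarrow> real vec set \<Rightarrow> real vec \<Rightarrow> real" where
  "D2_prob X C x = kcost {x} C / kcost X C"

text \<open>
  A history \<open>cs\<close> is the list of centers selected so far, in order of selection; the current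
  set of centers is \<open>set cs\<close>.
\<close>
definition exact_prob :: "real vec set \<Rightarrow> real vec list \<Rightarrow> real vec \<Rightarrow> real" where
  "exact_prob X cs x = (if cs = [] then 1 / real (card X) else D2_prob X (set cs) x)"

definition tv_dist :: "'a set \<Rightarrow> ('a \<Rightarrow> real) \<Rightarrow> ('a \<Rightarrow> real) \<Rightarrow> real" where
  "tv_dist X p q = 1 / 2 * (\<Sum>x\<in>X. \<bar>p x - q x\<bar>)"

text \<open>A sampling rule assigns to each history the distribution of the next center.\<close>
type_synonym sampling_rule = "real vec list \<Rightarrow> real vec pmf"

definition sampling_rule_on :: "real vec set \<Rightarrow> nat \<Rightarrow> sampling_rule \<Rightarrow> bool" where
  "sampling_rule_on X k q \<longleftrightarrow>
     (\<forall>cs. set cs \<subseteq> X \<and> length cs < k \<longrightarrow> set_pmf (q cs) \<subseteq> X)"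

definition support_preserving :: "real vec set \<Rightarrow> nat \<Rightarrow> sampling_rule \<Rightarrow> bool" where
  "support_preserving X k q \<longleftrightarrow>
     (\<forall>cs. set cs \<subseteq> X \<and> length cs < k \<longrightarrow>
        set_pmf (q cs) = {x \<in> X. exact_prob X cs x \<noteq> 0})"

definition tv_noisy :: "real \<Rightarrow> real vec set \<Rightarrow> nat \<Rightarrow> sampling_rule \<Rightarrow> bool" where
  "tv_noisy \<eta> X k q \<longleftrightarrow>
     (\<forall>cs. set cs \<subseteq> X \<and> length cs < k \<longrightarrow>
        tv_dist X (exact_prob X cs) (pmf (q cs)) \<le> \<eta>)"

primrec select_centers :: "sampling_rule \<Rightarrow> nat \<Rightarrow> real vec list pmf" where
  "select_centers q 0 = return_pmf []"
| "select_centers q (Suc j) =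
     bind_pmf (select_centers q j) (\<lambda>cs. map_pmf (\<lambda>c. cs @ [c]) (q cs))"

definition expected_cost :: "real vec set \<Rightarrow> nat \<Rightarrow> sampling_rule \<Rightarrow> real" where
  "expected_cost X k q =
     measure_pmf.expectation (select_centers q k) (\<lambda>cs. kcost X (set cs))"

text \<open>
  \<open>g k \<eta>\<close> is an approximation guarantee for every \<open>k\<close> and every run of noisy
  \<open>k\<close>-means++ in which each round, the uniform first one included, may deviate from the exact
  distribution by \<open>\<eta>\<close> in total variation.
\<close>
definition tv_noisy_guarantee :: "real \<Rightarrow> (nat \<Rightarrow> real \<Rightarrow> real) \<Rightarrow> bool" where
  "tv_noisy_guarantee \<eta> g \<longleftrightarrow>
     (\<forall>k d X q. kmeans_instance d k X \<and> sampling_rule_on X k q \<and> tv_noisy \<eta> X k q \<longrightarrow>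
        expected_cost X k q \<le> g k \<eta> * opt_cost d k X)"

end

theory Submission
  imports Defs
begin

text \<open>
  Take the points \<open>0\<close>, \<open>1\<close> and a far point \<open>T\<close> on the line, so that \<open>OPT\<^sub>2 \<le> 1\<close>. The mixture
  \<open>(1 - \<eta>) p + \<eta> \<delta>\<^sub>s\<close> is within total variation distance \<open>\<eta>\<close> of \<open>p\<close>, and it has the support of
  \<open>p\<close> as soon as \<open>p s > 0\<close>. If \<open>s = 1\<close> after the first center \<open>0\<close>, then the far point is missed
  with probability at least \<open>\<eta> / 3\<close>, at a cost of \<open>(T - 1)\<^sup>2\<close>, which is unbounded in \<open>T\<close>.
\<close>

section \<open>Squared distances and clustering cost\<close>

lemma sq_dist_eq_sum:
  assumes "x \<in> carrier_vec d" "c \<in> carrier_vec d"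
  shows "sq_dist x c = (\<Sum>i<d. (x $ i - c $ i)\<^sup>2)"
  using assms by (auto simp: sq_dist_def scalar_prod_def power2_eq_square lessThan_atLeast0)

lemma sq_dist_nonneg: "0 \<le> sq_dist x c"
  by (simp add: sq_dist_def scalar_prod_def sum_nonneg)

lemma sq_dist_eq_0_iff:
  assumes "x \<in> carrier_vec d" "c \<in> carrier_vec d"
  shows "sq_dist x c = 0 \<longleftrightarrow> x = c"
proof -
  have "sq_dist x c = 0 \<longleftrightarrow> (\<forall>i<d. x $ i = c $ i)"
    unfolding sq_dist_eq_sum[OF assms] by (subst sum_nonneg_eq_0_iff) auto
  then show ?thesis
    using assms by (auto intro!: eq_vecI)
qed

text \<open>The factor 2 is the price of squaring: in each coordinate the bound rearranges to
  \<open>0 \<le> (a + b - 2 * e)\<^sup>2\<close>.\<close>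

lemma sq_dist_triangle:
  assumes "x \<in> carrier_vec d" "y \<in> carrier_vec d" "c \<in> carrier_vec d"
  shows "sq_dist x y \<le> 2 * (sq_dist x c + sq_dist y c)"
proof -
  have *: "(a - b)\<^sup>2 \<le> 2 * ((a - e)\<^sup>2 + (b - e)\<^sup>2)" for a b e :: real
    using zero_le_power2[of "a + b - 2 * e"] by (simp add: power2_eq_square algebra_simps)
  have "sq_dist x y \<le> (\<Sum>i<d. 2 * ((x $ i - c $ i)\<^sup>2 + (y $ i - c $ i)\<^sup>2))"
    unfolding sq_dist_eq_sum[OF assms(1,2)] by (intro sum_mono *)
  also have "\<dots> = 2 * (sq_dist x c + sq_dist y c)"
    unfolding sq_dist_eq_sum[OF assms(1,3)] sq_dist_eq_sum[OF assms(2,3)]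
    by (simp only: sum.distrib sum_distrib_left[symmetric])
  finally show ?thesis .
qed

lemma Min_sq_dist_nonneg:
  assumes "finite C" "C \<noteq> {}"
  shows "0 \<le> Min (sq_dist x ` C)"
  using assms by (simp add: sq_dist_nonneg)

lemma kcost_nonneg:
  assumes "finite C" "C \<noteq> {}"
  shows "0 \<le> kcost X C"
  unfolding kcost_def by (intro sum_nonneg Min_sq_dist_nonneg assms)

text \<open>Applied to \<open>X\<close> it makes the normaliser of the
  \<open>D^2\<close>-distribution positive; applied to \<open>{s}\<close> it makes the weight of
  \<open>s\<close> positive.\<close>

lemma kcost_singleton_pos:
  assumes "finite X" "X \<subseteq> carrier_vec d" "c \<in> carrier_vec d" "x \<in> X" "x \<noteq> c"
  shows "0 < kcost X {c}"
proof -
  have "0 < sq_dist x c"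
    using assms sq_dist_nonneg[of x c] sq_dist_eq_0_iff[of x d c] by fastforce
  also have "\<dots> \<le> kcost X {c}"
    unfolding kcost_def using assms member_le_sum[of x X "\<lambda>x. sq_dist x c"]
    by (simp add: sq_dist_nonneg)
  finally show ?thesis .
qed

text \<open>By the pigeonhole principle two points are served by the same center.\<close>

lemma kcost_ge_separation:
  assumes X: "finite X" "X \<subseteq> carrier_vec d"
    and C: "C \<subseteq> carrier_vec d" "finite C" "C \<noteq> {}" "card C < card X"
    and sep: "\<And>x y. x \<in> X \<Longrightarrow> y \<in> X \<Longrightarrow> x \<noteq> y \<Longrightarrow> \<delta> \<le> sq_dist x y"
  shows "\<delta> / 2 \<le> kcost X C"
proof -
  have "\<exists>c\<in>C. Min (sq_dist x ` C) = sq_dist x c" for x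
  proof -
    have "Min (sq_dist x ` C) \<in> sq_dist x ` C"
      using C by (intro Min_in) auto
    then show ?thesis by auto
  qed
  then obtain f where f: "\<And>x. f x \<in> C" "\<And>x. Min (sq_dist x ` C) = sq_dist x (f x)"
    by metis
  have "\<not> inj_on f X"
    using card_inj_on_le[of f X C] f(1) C by (meson image_subsetI not_less)
  then obtain x y where xy: "x \<in> X" "y \<in> X" "x \<noteq> y" "f x = f y"
    by (auto simp: inj_on_def)
  have "\<delta> \<le> 2 * (sq_dist x (f x) + sq_dist y (f x))"
    using sep[OF xy(1-3)] sq_dist_triangle[of x d y "f x"] xy X C f(1)[of x] by fastforce
  also have "sq_dist x (f x) + sq_dist y (f x) = (\<Sum>z\<in>{x, y}. Min (sq_dist z ` C))"
    using xy f(2)[of x] f(2)[of y] by simp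
  also have "\<dots> \<le> kcost X C"
    unfolding kcost_def using xy X C by (intro sum_mono2) (auto intro!: Min_sq_dist_nonneg simp del: Min_ge_iff)
  finally show ?thesis by simp
qed

section \<open>Distributions on finite point sets and the expected cost\<close>

lemma D2_prob_nonneg:
  assumes "finite C" "C \<noteq> {}"
  shows "0 \<le> D2_prob X C x"
  unfolding D2_prob_def using assms by (simp add: kcost_nonneg)

lemma sum_D2_prob:
  assumes "kcost X C \<noteq> 0"
  shows "(\<Sum>x\<in>X. D2_prob X C x) = 1"
  using assms unfolding D2_prob_def by (simp add: sum_divide_distrib[symmetric]) (simp add: kcost_def)

lemma ex_pmf_on_finite:
  fixes f :: "'a \<Rightarrow> real"
  assumes "finite X" "\<And>x. x \<in> X \<Longrightarrow> 0 \<le> f x" "(\<Sum>x\<in>X. f x) = 1"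
  shows "\<exists>p. (\<forall>x\<in>X. pmf p x = f x) \<and> set_pmf p = {x \<in> X. f x \<noteq> 0}"
proof -
  define g where "g x = (if x \<in> X then f x else 0)" for x
  have g: "\<And>x. 0 \<le> g x" "(\<Sum>x\<in>X. g x) = 1"
    using assms by (auto simp: g_def)
  have "(\<integral>\<^sup>+ x. ennreal (g x) \<partial>count_space UNIV) = (\<Sum>x\<in>X. ennreal (g x))"
    using assms(1) by (intro nn_integral_count_space'[of X]) (auto simp: g_def)
  also have "\<dots> = 1"
    using g by (simp add: sum_ennreal)
  finally have "pmf (embed_pmf g) x = g x" for x
    using g by (intro pmf_embed_pmf) auto
  then show ?thesis
    by (intro exI[of _ "embed_pmf g"]) (auto simp: set_pmf_iff g_def split: if_splits)
qed

text \<open>Since \<open>s \<noteq> c\<close>, the exact weight of \<open>s\<close> is positive, so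
  moving mass to \<open>s\<close> adds nothing to the support; since \<open>\<eta> < 1\<close>,
  nothing is lost from it.\<close>

lemma ex_noisy_D2_pmf:
  assumes \<eta>: "0 < \<eta>" "\<eta> < 1"
    and X: "finite X" "X \<subseteq> carrier_vec d" and cs: "c \<in> X" "s \<in> X" "s \<noteq> c"
  shows "\<exists>p. set_pmf p = {x \<in> X. D2_prob X {c} x \<noteq> 0} \<and>
             tv_dist X (D2_prob X {c}) (pmf p) \<le> \<eta> \<and> \<eta> \<le> pmf p s"
proof -
  let ?D = "D2_prob X {c}"
  let ?i = "\<lambda>x. if x = s then 1 else 0 :: real"
  define f where "f x = (1 - \<eta>) * ?D x + \<eta> * ?i x" for x
  have pos: "0 < kcost X {c}" "0 < kcost {s} {c}"
    using X cs by (auto intro: kcost_singleton_pos[of _ d c s])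
  have D: "0 \<le> ?D x" for x
    by (simp add: D2_prob_nonneg)
  have sumD: "(\<Sum>x\<in>X. ?D x) = 1"
    using pos by (simp add: sum_D2_prob)
  have Ds: "0 < ?D s"
    using pos by (simp add: D2_prob_def)
  have sumi: "(\<Sum>x\<in>X. ?i x) = 1"
    using X cs by simp
  have f0: "0 \<le> f x" for x
    using D[of x] \<eta> by (simp add: f_def)
  have "(\<Sum>x\<in>X. f x) = (1 - \<eta>) * (\<Sum>x\<in>X. ?D x) + \<eta> * (\<Sum>x\<in>X. ?i x)"
    by (simp only: f_def sum.distrib sum_distrib_left)
  then have "(\<Sum>x\<in>X. f x) = 1"
    unfolding sumD sumi by simp
  then obtain p where p: "\<And>x. x \<in> X \<Longrightarrow> pmf p x = f x" "set_pmf p = {x \<in> X. f x \<noteq> 0}"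
    using ex_pmf_on_finite[of X f] X f0 by blast
  have "f x \<noteq> 0 \<longleftrightarrow> ?D x \<noteq> 0" for x
    using \<eta> Ds D[of x] by (auto simp: f_def add_nonneg_eq_0_iff)
  moreover have "tv_dist X ?D (pmf p) \<le> \<eta>"
  proof -
    \<comment> \<open>Both \<open>?D\<close> and \<open>?i\<close> have total mass 1, so these
      bounds sum to \<open>2 * \<eta>\<close>, and the factor 1/2 in \<open>tv_dist\<close> leaves
      \<open>\<eta>\<close>.\<close>
    have "\<bar>?D x - pmf p x\<bar> \<le> \<eta> * (?D x + ?i x)" if "x \<in> X" for x
    proof -
      have "?D x - pmf p x = \<eta> * (?D x - ?i x)"
        using that by (simp add: p(1) f_def algebra_simps)
      moreover have "\<bar>?D x - ?i x\<bar> \<le> ?D x + ?i x"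
        using D[of x] by auto
      ultimately show ?thesis
        using \<eta> by (simp add: abs_mult)
    qed
    then have "(\<Sum>x\<in>X. \<bar>?D x - pmf p x\<bar>) \<le> (\<Sum>x\<in>X. \<eta> * (?D x + ?i x))"
      by (rule sum_mono)
    also have "\<dots> = \<eta> * ((\<Sum>x\<in>X. ?D x) + (\<Sum>x\<in>X. ?i x))"
      by (simp only: sum.distrib sum_distrib_left[symmetric])
    finally show ?thesis
      unfolding sumD sumi by (simp add: tv_dist_def)
  qed
  moreover have "\<eta> \<le> pmf p s"
    using \<eta> Ds cs by (simp add: p(1) f_def)
  ultimately show ?thesis
    using p(2) by auto
qed

text \<open>Only the outcome \<open>[a, b]\<close> is kept from the expectation; all other outcomes
  contribute nonnegative cost.\<close>

lemma expected_cost_2_ge: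
  assumes X: "finite X" "a \<in> X" and q0: "q [] = pmf_of_set X"
    and supp: "\<And>c. c \<in> X \<Longrightarrow> set_pmf (q [c]) \<subseteq> X"
  shows "pmf (q [a]) b / card X * kcost X {a, b} \<le> expected_cost X 2 q"
proof -
  let ?S = "select_centers q 2"
  have S: "?S = bind_pmf (pmf_of_set X) (\<lambda>c. map_pmf (\<lambda>e. [c, e]) (q [c]))"
    by (simp add: numeral_2_eq_2 bind_return_pmf q0 map_pmf_def bind_assoc_pmf)
  have ne: "X \<noteq> {}"
    using X by auto
  have sub: "set_pmf ?S \<subseteq> (\<lambda>(c, e). [c, e]) ` (X \<times> X)"
  proof
    fix cs assume "cs \<in> set_pmf ?S"
    then obtain c e where "c \<in> X" "e \<in> set_pmf (q [c])" "cs = [c, e]"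
      unfolding S using X ne by auto
    then show "cs \<in> (\<lambda>(c, e). [c, e]) ` (X \<times> X)"
      using supp[of c] by (intro image_eqI[of _ _ "(c, e)"]) auto
  qed
  have pmf_S: "pmf ?S [a, b] = pmf (q [a]) b / card X"
  proof -
    have "pmf (map_pmf (\<lambda>e. [c, e]) (q [c])) [a, b] = (if c = a then pmf (q [a]) b else 0)" for c
    proof (cases "c = a")
      case True
      then show ?thesis
        using pmf_map_inj'[of "\<lambda>e. [a, e]" "q [a]" b] by (simp add: inj_def)
    next
      case False
      then have "[a, b] \<notin> set_pmf (map_pmf (\<lambda>e. [c, e]) (q [c]))"
        by auto
      then have "pmf (map_pmf (\<lambda>e. [c, e]) (q [c])) [a, b] = 0"
        by (rule iffD2[OF pmf_eq_0_set_pmf])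
      then show ?thesis
        using False by (simp only: if_False)
    qed
    then show ?thesis
      unfolding S using X ne by (simp add: pmf_bind_pmf_of_set)
  qed
  \<comment> \<open>The point \<open>b\<close> is not assumed to lie in \<open>X\<close>. Adding
    \<open>[a, b]\<close> makes it an index of the sum in any case; outside the support it has
    weight 0.\<close>
  let ?I = "(\<lambda>(c, e). [c, e]) ` (X \<times> X) \<union> {[a, b]}"
  have "expected_cost X 2 q = (\<Sum>cs\<in>?I. kcost X (set cs) * pmf ?S cs)"
    unfolding expected_cost_def using X sub
    by (subst integral_measure_pmf_real[of ?I]) auto
  also have "\<dots> \<ge> kcost X (set [a, b]) * pmf ?S [a, b]"
    using X by (intro member_le_sum) (auto intro!: mult_nonneg_nonneg kcost_nonneg)
  finally show ?thesis
    by (simp add: pmf_S mult.commute)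
qed

section \<open>The bad instance on the line\<close>

definition real_vec1 :: "real \<Rightarrow> real vec" where
  "real_vec1 a = vec 1 (\<lambda>_. a)"

lemma real_vec1_carrier [simp]: "real_vec1 a \<in> carrier_vec (Suc 0)"
  by (simp add: real_vec1_def)

lemma real_vec1_eq_iff [simp]: "real_vec1 a = real_vec1 b \<longleftrightarrow> a = b"
  by (auto simp: real_vec1_def vec_eq_iff)

lemma sq_dist_real_vec1 [simp]: "sq_dist (real_vec1 a) (real_vec1 b) = (a - b)\<^sup>2"
  by (simp add: sq_dist_eq_sum[of _ "Suc 0"]) (simp add: real_vec1_def)

lemma ex_bad_noisy_instance:
  fixes \<eta> M :: real
  assumes \<eta>: "0 < \<eta>" "\<eta> < 1"
  shows "\<exists>d X q. kmeans_instance d 2 X \<and> sampling_rule_on X 2 q \<and> support_preserving X 2 q \<and>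
           q [] = pmf_of_set X \<and> (\<forall>c\<in>X. tv_dist X (D2_prob X {c}) (pmf (q [c])) \<le> \<eta>) \<and>
           0 < opt_cost d 2 X \<and> expected_cost X 2 q / opt_cost d 2 X > M"
proof -
  \<comment> \<open>With \<open>u = 3 * \<bar>M\<bar> / \<eta>\<close> one has
    \<open>T - 1 = 1 + u\<close>, whose square exceeds \<open>u\<close>; this beats the probability
    \<open>\<eta> / 3\<close>. The summand 2 keeps distinct points at distance at least 1.\<close>
  define T where "T = 2 + 3 * \<bar>M\<bar> / \<eta>"
  have T: "2 \<le> T"
    using \<eta> by (simp add: T_def)
  let ?v = real_vec1
  define X where "X = {?v 0, ?v 1, ?v T}"
  have X: "finite X" "X \<subseteq> carrier_vec 1" and cardX: "card X = 3"
    using T by (auto simp: X_def)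
  \<comment> \<open>Only \<open>s (?v 0) = ?v 1\<close> enters the cost bound; for other first
    centers \<open>s c\<close> is just some point of \<open>X\<close> different from
    \<open>c\<close>.\<close>
  define s where "s c = (if c = ?v 0 then ?v 1 else ?v 0)" for c
  have s: "s c \<in> X" "s c \<noteq> c" for c
    by (auto simp: s_def X_def)
  have "\<forall>c\<in>X. \<exists>p. set_pmf p = {x \<in> X. D2_prob X {c} x \<noteq> 0} \<and>
      tv_dist X (D2_prob X {c}) (pmf p) \<le> \<eta> \<and> \<eta> \<le> pmf p (s c)"
    by (intro ballI ex_noisy_D2_pmf[OF \<eta> X] s)
  then obtain P where "\<forall>c\<in>X. set_pmf (P c) = {x \<in> X. D2_prob X {c} x \<noteq> 0} \<and>
      tv_dist X (D2_prob X {c}) (pmf (P c)) \<le> \<eta> \<and> \<eta> \<le> pmf (P c) (s c)"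
    by (elim exE[OF bchoice])
  then have P: "\<And>c. c \<in> X \<Longrightarrow> set_pmf (P c) = {x \<in> X. D2_prob X {c} x \<noteq> 0}"
      "\<And>c. c \<in> X \<Longrightarrow> tv_dist X (D2_prob X {c}) (pmf (P c)) \<le> \<eta>"
      "\<And>c. c \<in> X \<Longrightarrow> \<eta> \<le> pmf (P c) (s c)"
    by simp_all
  \<comment> \<open>Choosing two centers consults only histories of length below 2, so the value on
    longer ones is arbitrary.\<close>
  define q where "q cs = (if cs = [] then pmf_of_set X else P (hd cs))" for cs
  have short: "cs = [] \<or> (\<exists>c\<in>X. cs = [c])" if "set cs \<subseteq> X" "length cs < 2" for cs
    using that by (cases cs; cases "tl cs") auto
  have supp: "support_preserving X 2 q"
    unfolding support_preserving_def
  proof (intro allI impI)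
    fix cs assume "set cs \<subseteq> X \<and> length cs < 2"
    then show "set_pmf (q cs) = {x \<in> X. exact_prob X cs x \<noteq> 0}"
      using short[of cs] X cardX P(1) by (auto simp: q_def exact_prob_def X_def)
  qed
  then have on: "sampling_rule_on X 2 q"
    by (auto simp: support_preserving_def sampling_rule_on_def)
  let ?CS = "{C :: real vec set. C \<subseteq> carrier_vec 1 \<and> finite C \<and> card C = 2}"
  have C0: "{?v 0, ?v T} \<in> ?CS"
    using T by auto
  have sep: "1 \<le> sq_dist x y" if "x \<in> X" "y \<in> X" "x \<noteq> y" for x y
  proof -
    have "1 \<le> T\<^sup>2" "1 \<le> (T - 1)\<^sup>2"
      using T power_mono[of 1 T 2] power_mono[of 1 "T - 1" 2] by simp_all
    then show ?thesis
      using that by (auto simp: X_def power2_commute[of 1 T])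
  qed
  \<comment> \<open>Two centers cannot serve three points of separation 1 for free. Only positivity
    of the bound matters: the optimum has to be a legitimate denominator.\<close>
  have "1 / 2 \<le> opt_cost 1 2 X"
    unfolding opt_cost_def
  proof (rule cINF_greatest)
    show "?CS \<noteq> {}"
      using C0 by blast
    show "1 / 2 \<le> kcost X C" if "C \<in> ?CS" for C
    proof (rule kcost_ge_separation[OF X _ _ _ _ sep])
      show "C \<subseteq> carrier_vec 1" "finite C" "C \<noteq> {}" "card C < card X"
        using that cardX by auto
    qed
  qed
  then have opt_pos: "0 < opt_cost 1 2 X"
    by simp
  have "opt_cost 1 2 X \<le> kcost X {?v 0, ?v T}"
    unfolding opt_cost_def
  proof (rule cINF_lower[OF _ C0])
    show "bdd_below (kcost X ` ?CS)"
      by (rule bdd_belowI2[of _ 0]) (auto intro!: kcost_nonneg)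
  qed
  \<comment> \<open>With centers 0 and \<open>T\<close>, only the point 1 pays, and it pays
    1.\<close>
  also have "\<dots> \<le> 1"
    using T by (simp add: kcost_def X_def)
  finally have opt_le: "opt_cost 1 2 X \<le> 1" .
  have "3 * \<bar>M\<bar> / \<eta> < (T - 1)\<^sup>2"
  proof -
    have "u < (1 + u)\<^sup>2" if "0 \<le> u" for u :: real
      using that zero_le_power2[of u] unfolding power2_sum one_power2 by linarith
    from this[of "3 * \<bar>M\<bar> / \<eta>"] show ?thesis
      using \<eta> by (simp add: T_def)
  qed
  then have "\<bar>M\<bar> < \<eta> / 3 * (T - 1)\<^sup>2"
    using \<eta> by (simp add: field_simps)
  also have "(T - 1)\<^sup>2 \<le> kcost X {?v 0, ?v 1}"
  proof -
    have "(T - 1)\<^sup>2 \<le> T\<^sup>2"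
      using T by (intro power_mono) auto
    then show ?thesis
      using T by (simp add: kcost_def X_def)
  qed
  \<comment> \<open>The first center is 0 with probability 1/3, and then 1 follows with probability
    at least \<open>\<eta>\<close>.\<close>
  then have "\<eta> / 3 * (T - 1)\<^sup>2 \<le> pmf (q [?v 0]) (?v 1) / card X * kcost X {?v 0, ?v 1}"
    using \<eta> P(3)[of "?v 0"] cardX
    by (intro mult_mono) (auto simp: q_def s_def X_def)
  also have "\<dots> \<le> expected_cost X 2 q"
    using X P(1) by (intro expected_cost_2_ge) (auto simp: q_def X_def)
  finally have "\<bar>M\<bar> < expected_cost X 2 q" .
  \<comment> \<open>Passing to \<open>\<bar>M\<bar>\<close> covers negative \<open>M\<close>, for
    which an upper bound on the optimum alone says nothing.\<close>
  moreover have "M * opt_cost 1 2 X \<le> \<bar>M\<bar>"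
  proof -
    have "M * opt_cost 1 2 X \<le> \<bar>M\<bar> * opt_cost 1 2 X"
      using opt_pos by (intro mult_right_mono) auto
    also have "\<dots> \<le> \<bar>M\<bar>"
      using opt_le by (simp add: mult_left_le)
    finally show ?thesis .
  qed
  ultimately have "expected_cost X 2 q / opt_cost 1 2 X > M"
    using opt_pos by (simp add: pos_less_divide_eq)
  moreover have "kmeans_instance 1 2 X"
    using X cardX by (simp add: kmeans_instance_def)
  moreover have "\<forall>c\<in>X. tv_dist X (D2_prob X {c}) (pmf (q [c])) \<le> \<eta>"
    using P(2) by (simp add: q_def)
  moreover have "q [] = pmf_of_set X"
    by (simp add: q_def)
  ultimately show ?thesis
    using on supp opt_pos by blast
qed

section \<open>Failure of every guarantee\<close>

text \<open>\<open>tv_noisy\<close> also constrains the first round; an exactly uniform first choice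
  has distance 0 there, leaving only the one-element histories.\<close>

lemma tv_noisy_2I:
  assumes "0 \<le> \<eta>" "finite X" "q [] = pmf_of_set X"
    and "\<And>c. c \<in> X \<Longrightarrow> tv_dist X (D2_prob X {c}) (pmf (q [c])) \<le> \<eta>"
  shows "tv_noisy \<eta> X 2 q"
  unfolding tv_noisy_def
proof (intro allI impI)
  fix cs assume cs: "set cs \<subseteq> X \<and> length cs < 2"
  show "tv_dist X (exact_prob X cs) (pmf (q cs)) \<le> \<eta>"
  proof (cases cs)
    case Nil
    have "(\<Sum>x\<in>X. \<bar>1 / real (card X) - pmf (pmf_of_set X) x\<bar>) = 0"
      using assms(2) by (intro sum.neutral ballI, subst pmf_of_set) auto
    then show ?thesis
      using Nil assms(1,3) by (simp add: tv_dist_def exact_prob_def)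
  next
    case (Cons c cs')
    then have "cs = [c]" "c \<in> X"
      using cs by auto
    moreover have "exact_prob X [c] = D2_prob X {c}"
      by (rule ext) (simp add: exact_prob_def)
    ultimately show ?thesis
      using assms(4) by simp
  qed
qed

theorem theorem5p6:
  fixes \<eta> :: real
  assumes "0 < \<eta>" and "\<eta> < 1"
  shows "(\<forall>M::real. \<exists>d X q.
            kmeans_instance d 2 X \<and>
            sampling_rule_on X 2 q \<and>
            support_preserving X 2 q \<and>
            q [] = pmf_of_set X \<and>
            (\<forall>c\<in>X. tv_dist X (D2_prob X {c}) (pmf (q [c])) \<le> \<eta>) \<and>
            0 < opt_cost d 2 X \<and>
            expected_cost X 2 q / opt_cost d 2 X > M) \<and>
         (\<nexists>g. tv_noisy_guarantee \<eta> g)"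
proof
  show "\<nexists>g. tv_noisy_guarantee \<eta> g"
  proof
    assume "\<exists>g. tv_noisy_guarantee \<eta> g"
    then obtain g where g: "tv_noisy_guarantee \<eta> g" ..
    \<comment> \<open>A guarantee fixes the number \<open>g 2 \<eta>\<close> before the instance is
      chosen, so it can serve as the bound \<open>M\<close>; the case of two centers already refutes
      it.\<close>
    obtain d X q where inst: "kmeans_instance d 2 X" "sampling_rule_on X 2 q" "q [] = pmf_of_set X"
        "\<forall>c\<in>X. tv_dist X (D2_prob X {c}) (pmf (q [c])) \<le> \<eta>"
      and bad: "0 < opt_cost d 2 X" "expected_cost X 2 q / opt_cost d 2 X > g 2 \<eta>"
      using ex_bad_noisy_instance[OF assms, of "g 2 \<eta>"] by blast
    have "tv_noisy \<eta> X 2 q"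
      using inst assms by (intro tv_noisy_2I) (auto simp: kmeans_instance_def)
    then have "expected_cost X 2 q \<le> g 2 \<eta> * opt_cost d 2 X"
      using g inst by (auto simp: tv_noisy_guarantee_def)
    then show False
      using bad by (simp add: pos_less_divide_eq)
  qed
qed (intro allI ex_bad_noisy_instance assms)

end
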